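(* Let $d,L\ge1$, let $\alpha\in\Lambda_{d,L}$ and let $w\in\{+,-\}^n$ for some $n\ge0$. There is a bijection between $\mathrm{OCT}^w_{d,L}(\alpha,\cdot)$ and the set of symmetric cylindric growth diagrams on an $n\times n$ grid where vertices $(0,n)$ and $(n,0)$ have label $\alpha$. In particular, $|\mathrm{OCT}^w_{d,L}(\alpha,\cdot)|$ is independent of $w\in\{+,-\}^n$, and it equals $|\mathrm{SCT}^n_{d,L}(\alpha/\cdot)|=|\mathrm{SCT}^n_{d,L}(\cdot/\alpha)|$.
   Context: Cylindric shapes and tableaux. The cylinder is $\mathcal{C}_{d,L}=\mathbb{Z}^2/(-d,L)\mathbb{Z}$; its elements (cells) are classes $\langle i,j\rangle=(i,j)+(-d,L)\mathbb{Z}$, where $i$ is the row and $j$ the column. A cylindric shape of period $(d,L)$ is a doubly infinite weakly decreasing integer sequence $\lambda=(\lambda_i)_{i\in\mathbb{Z}}$ with $\lambda_i=\lambda_{i+d}+L$ for all $i$. $\Lambda_{d,L}$ is the set of these. The Young diagram is $Y_\lambda=\{\langle i,j\rangle: j\le\lambda_i\}$. Write $\mu\subseteq\lambda$ if $\mu_i\le\lambda_i$ for all $i$; then $Y_{\lambda/\mu}=Y_\lambda\setminus Y_\mu$, with cardinality $|\lambda/\mu|=\sum_{i=1}^d(\lambda_i-\mu_i)$. Adding a cell to (removing a cell from) row $i$ of a shape means increasing (decreasing) $\lambda_i$ by $1$, and hence $\lambda_{i+kd}$ by the same amount for all $k\in\mathbb{Z}$, the result being again a shape. A standard cylindric tableau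 of shape $\lambda/\mu$ (outer shape $\lambda$, inner shape $\mu$) is a filling of the cells of $Y_{\lambda/\mu}$ with $1,\dots,|\lambda/\mu|$, each used exactly once, increasing along rows (from $\langle i,j\rangle$ to $\langle i,j+1\rangle$) and columns (from $\langle i,j\rangle$ to $\langle i+1,j\rangle$). $\mathrm{SCT}^n_{d,L}(\cdot/\alpha)$ and $\mathrm{SCT}^n_{d,L}(\alpha/\cdot)$ are the sets of those with $n$ cells and with inner shape $\alpha$, respectively outer shape $\alpha$. Oscillating cylindric tableaux. For $w\in\{+,-\}^n$, $\mathrm{OCT}^w_{d,L}(\alpha,\cdot)$ is the set of sequences $\rho^0,\rho^1,\dots,\rho^n$ in $\Lambda_{d,L}$ with $\rho^0=\alpha$, such that for each $k$, $\rho^k$ is obtained from $\rho^{k-1}$ by adding one cell if the $k$th letter of $w$ is $+$, and by removing one cell if it is $-$. Cylindric growth diagrams. A cylindric growth diagram on an $m\times n$ grid (for standard tableaux) is a labeling of the vertices $(x,y)$, $0\le x\le m$, $0\le y\le n$, by elements of $\Lambda_{d,L}$ such that for every grid edge from $(x,y)$ to $(x+1,y)$ or to $(x,y+1)$ the label of the second endpoint is obtained from that of the first by adding exactly one cell, and such that every unit square, with lower-left, upper-left, lower-right, upper-right labels $\rho^{LL},\rho^{UL},\rho^{LR},\rho^{UR}$, satisfies the forward local rule: (F1) if $\rho^{UL}\ne\rho^{LR}$, then $\rho^{UR}_i=\max\{\rho^{UL}_i,\rho^{LR}_i\}$ for all $i$; (F2) if $\rho^{UL}=\rho^{LR}$,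 this shape being obtained from $\rho^{LL}$ by adding a cell to row $i$, then $\rho^{UR}$ is obtained from $\rho^{UL}=\rho^{LR}$ by adding a cell to row $i+1$ (row indices modulo $d$). When $m=n$, the diagram is symmetric if it is invariant under reflection along $y=x$, i.e. vertices $(x,y)$ and $(y,x)$ have the same label for all $x,y$. *)

theory Defs
  imports "HOL-Library.FuncSet"
begin

definition cyl_rel :: "nat \<Rightarrow> nat \<Rightarrow> ((int \<times> int) \<times> (int \<times> int)) set" where
  "cyl_rel d L = {((i, j), (i', j')). \<exists>k::int. i' = i - k * int d \<and> j' = j + k * int L}"

definition cell :: "nat \<Rightarrow> nat \<Rightarrow> int \<Rightarrow> int \<Rightarrow> (int \<times> int) set" where
  "cell d L i j = cyl_rel d L `` {(i, j)}"

definition cyl_shapes :: "nat \<Rightarrow> nat \<Rightarrow> (int \<Rightarrow> int) set" where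
  "cyl_shapes d L = {\<nu>. antimono \<nu> \<and> (\<forall>i. \<nu> i = \<nu> (i + int d) + int L)}"

definition young_diagram :: "nat \<Rightarrow> nat \<Rightarrow> (int \<Rightarrow> int) \<Rightarrow> (int \<times> int) set set" where
  "young_diagram d L \<nu> = {cell d L i j | i j. j \<le> \<nu> i}"

definition skew_diagram ::
  "nat \<Rightarrow> nat \<Rightarrow> (int \<Rightarrow> int) \<Rightarrow> (int \<Rightarrow> int) \<Rightarrow> (int \<times> int) set set" where
  "skew_diagram d L \<nu> \<mu> = young_diagram d L \<nu> - young_diagram d L \<mu>"

definition adds_cell_in_row ::
  "nat \<Rightarrow> nat \<Rightarrow> int \<Rightarrow> (int \<Rightarrow> int) \<Rightarrow> (int \<Rightarrow> int) \<Rightarrow> bool" where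
  "adds_cell_in_row d L i \<mu> \<nu> \<longleftrightarrow>
     \<mu> \<in> cyl_shapes d L \<and> \<nu> \<in> cyl_shapes d L \<and>
     (\<forall>r. \<nu> r = (if \<exists>k::int. r = i + k * int d then \<mu> r + 1 else \<mu> r))"

definition removes_cell_in_row ::
  "nat \<Rightarrow> nat \<Rightarrow> int \<Rightarrow> (int \<Rightarrow> int) \<Rightarrow> (int \<Rightarrow> int) \<Rightarrow> bool" where
  "removes_cell_in_row d L i \<nu> \<mu> \<longleftrightarrow>
     \<nu> \<in> cyl_shapes d L \<and> \<mu> \<in> cyl_shapes d L \<and>
     (\<forall>r. \<mu> r = (if \<exists>k::int. r = i + k * int d then \<nu> r - 1 else \<nu> r))"

definition adds_cell :: "nat \<Rightarrow> nat \<Rightarrow> (int \<Rightarrow> int) \<Rightarrow> (int \<Rightarrow> int) \<Rightarrow> bool" where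
  "adds_cell d L \<mu> \<nu> \<longleftrightarrow> (\<exists>i. adds_cell_in_row d L i \<mu> \<nu>)"

definition removes_cell :: "nat \<Rightarrow> nat \<Rightarrow> (int \<Rightarrow> int) \<Rightarrow> (int \<Rightarrow> int) \<Rightarrow> bool" where
  "removes_cell d L \<nu> \<mu> \<longleftrightarrow> (\<exists>i. removes_cell_in_row d L i \<nu> \<mu>)"

text \<open>First the outer shape, then the inner one. A filling is a function on cells that is
  undefined off the skew diagram, so that distinct functions are distinct fillings.\<close>

definition is_sct ::
  "nat \<Rightarrow> nat \<Rightarrow> (int \<Rightarrow> int) \<Rightarrow> (int \<Rightarrow> int) \<Rightarrow> ((int \<times> int) set \<Rightarrow> nat) \<Rightarrow> bool" where
  "is_sct d L \<nu> \<mu> T \<longleftrightarrow>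
     \<nu> \<in> cyl_shapes d L \<and> \<mu> \<in> cyl_shapes d L \<and> (\<forall>i. \<mu> i \<le> \<nu> i) \<and>
     T \<in> extensional (skew_diagram d L \<nu> \<mu>) \<and>
     bij_betw T (skew_diagram d L \<nu> \<mu>) {1..card (skew_diagram d L \<nu> \<mu>)} \<and>
     (\<forall>i j. cell d L i j \<in> skew_diagram d L \<nu> \<mu> \<longrightarrow>
            cell d L i (j + 1) \<in> skew_diagram d L \<nu> \<mu> \<longrightarrow>
            T (cell d L i j) < T (cell d L i (j + 1))) \<and>
     (\<forall>i j. cell d L i j \<in> skew_diagram d L \<nu> \<mu> \<longrightarrow>
            cell d L (i + 1) j \<in> skew_diagram d L \<nu> \<mu> \<longrightarrow>
            T (cell d L i j) < T (cell d L (i + 1) j))"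

text \<open>A tableau with prescribed inner (resp. outer) shape is the pair of its outer
  (resp. inner) shape and its filling.\<close>

definition SCT_inner ::
  "nat \<Rightarrow> nat \<Rightarrow> nat \<Rightarrow> (int \<Rightarrow> int) \<Rightarrow> ((int \<Rightarrow> int) \<times> ((int \<times> int) set \<Rightarrow> nat)) set" where
  "SCT_inner d L n \<alpha> =
     {(\<nu>, T). is_sct d L \<nu> \<alpha> T \<and> card (skew_diagram d L \<nu> \<alpha>) = n}"

definition SCT_outer ::
  "nat \<Rightarrow> nat \<Rightarrow> nat \<Rightarrow> (int \<Rightarrow> int) \<Rightarrow> ((int \<Rightarrow> int) \<times> ((int \<times> int) set \<Rightarrow> nat)) set" where
  "SCT_outer d L n \<alpha> =
     {(\<mu>, T). is_sct d L \<alpha> \<mu> T \<and> card (skew_diagram d L \<alpha> \<mu>) = n}"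

datatype sign = Plus | Minus

definition OCT ::
  "nat \<Rightarrow> nat \<Rightarrow> sign list \<Rightarrow> (int \<Rightarrow> int) \<Rightarrow> (int \<Rightarrow> int) list set" where
  "OCT d L w \<alpha> =
     {\<rho>. length \<rho> = length w + 1 \<and> set \<rho> \<subseteq> cyl_shapes d L \<and> \<rho> ! 0 = \<alpha> \<and>
         (\<forall>k < length w. case w ! k of
              Plus \<Rightarrow> adds_cell d L (\<rho> ! k) (\<rho> ! (k + 1))
            | Minus \<Rightarrow> removes_cell d L (\<rho> ! k) (\<rho> ! (k + 1)))}"

definition forward_rule ::
  "nat \<Rightarrow> nat \<Rightarrow> (int \<Rightarrow> int) \<Rightarrow> (int \<Rightarrow> int) \<Rightarrow> (int \<Rightarrow> int) \<Rightarrow> (int \<Rightarrow> int) \<Rightarrow> bool" where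
  "forward_rule d L LL UL LR UR \<longleftrightarrow>
     (UL \<noteq> LR \<longrightarrow> (\<forall>i. UR i = max (UL i) (LR i))) \<and>
     (UL = LR \<longrightarrow> (\<forall>i. adds_cell_in_row d L i LL UL \<longrightarrow> adds_cell_in_row d L (i + 1) UL UR))"

definition growth_diagrams ::
  "nat \<Rightarrow> nat \<Rightarrow> nat \<Rightarrow> nat \<Rightarrow> (nat \<times> nat \<Rightarrow> (int \<Rightarrow> int)) set" where
  "growth_diagrams d L m n =
     {\<rho> \<in> ({0..m} \<times> {0..n}) \<rightarrow>\<^sub>E cyl_shapes d L.
        (\<forall>x y. x < m \<longrightarrow> y \<le> n \<longrightarrow> adds_cell d L (\<rho> (x, y)) (\<rho> (x + 1, y))) \<and>
        (\<forall>x y. x \<le> m \<longrightarrow> y < n \<longrightarrow> adds_cell d L (\<rho> (x, y)) (\<rho> (x, y + 1))) \<and>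
        (\<forall>x y. x < m \<longrightarrow> y < n \<longrightarrow>
           forward_rule d L (\<rho> (x, y)) (\<rho> (x, y + 1)) (\<rho> (x + 1, y)) (\<rho> (x + 1, y + 1)))}"

definition symmetric_growth_diagrams ::
  "nat \<Rightarrow> nat \<Rightarrow> nat \<Rightarrow> (nat \<times> nat \<Rightarrow> (int \<Rightarrow> int)) set" where
  "symmetric_growth_diagrams d L n =
     {\<rho> \<in> growth_diagrams d L n n. \<forall>x y. x \<le> n \<longrightarrow> y \<le> n \<longrightarrow> \<rho> (x, y) = \<rho> (y, x)}"

end

theory Submission
  imports Defs
begin

text \<open>
  The proof counts everything with two linear operators. For a function \<open>f\<close> from shapes to natural
  numbers, let \<open>U f \<alpha>\<close> be the sum of \<open>f\<close> over all shapes obtained from \<open>\<alpha>\<close> by adding a cell, and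
  \<open>D f \<alpha>\<close> the sum over those obtained by removing one. The number of oscillating tableaux that start
  at \<open>\<alpha>\<close> and follow a word is the value at \<open>\<alpha>\<close> of the product of the operators spelled by the word,
  applied to the constant function \<open>1\<close> (\<open>card_OCT\<close>).

  The local rule of growth diagrams says two things about \<open>U\<close> and \<open>D\<close>. A square can be completed
  upwards from its lower left corner or downwards from its upper right corner, and the two completions
  are inverse to each other. Hence the pairs that go up from \<open>\<alpha>\<close> and then down to \<open>\<gamma>\<close> are as many as
  those that go down and then up, so \<open>U\<close> and \<open>D\<close> commute (\<open>U_D_commute\<close>). The degenerate squares,
  where a cell removed from row \<open>i\<close> corresponds to a cell added to row \<open>i + 1\<close>, match the ways of
  adding a cell with the ways of removing one, so \<open>U 1 = D 1\<close> (\<open>U_one_eq_D_one\<close>). On the cylinder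
  there is no exceptional first row, which is why both identities hold without a correction term.
  Now any letter plus can be pushed to the end of the word, where \<open>U\<close> meets the constant \<open>1\<close> and turns
  into \<open>D\<close>. So every word of length \<open>n\<close> gives the same function \<open>D\<^sup>n 1 = U\<^sup>n 1\<close> (\<open>word_op_eq\<close>).

  The other objects are counted by the two constant words. A symmetric growth diagram is
  determined by its left edge, and its left edge, read downwards from \<open>\<alpha>\<close>, can be any chain of
  cell removals (\<open>restrict_left_edge_bij\<close>). Deleting the largest entry of a standard tableau removes a
  corner cell of the outer shape and leaves a standard tableau (\<open>add_entry_bij\<close>). Iterating this,
  tableaux of outer shape \<open>\<alpha>\<close> are counted by \<open>D\<^sup>n 1\<close> and those of inner shape \<open>\<alpha>\<close> by \<open>U\<^sup>n 1\<close>. The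
  bijection between oscillating tableaux and diagrams comes from the equality of two finite
  cardinalities.
\<close>

section \<open>Shapes and rows\<close>

locale cylinder =
  fixes d L :: nat
  assumes d_pos: "d \<ge> 1" and L_pos: "L \<ge> 1"
begin

abbreviation shapes :: "(int \<Rightarrow> int) set" ("\<Lambda>") where
  "\<Lambda> \<equiv> cyl_shapes d L"

abbreviation covered :: "(int \<Rightarrow> int) \<Rightarrow> (int \<Rightarrow> int) \<Rightarrow> bool" (infix "\<lessdot>" 50) where
  "\<mu> \<lessdot> \<nu> \<equiv> adds_cell d L \<mu> \<nu>"

text \<open>The indicator function of the residue class of row \<open>i\<close>: adding a cell to row \<open>i\<close> of a shape
  means adding this function, which turns questions about cells into arithmetic.\<close>

definition row_ind :: "int \<Rightarrow> int \<Rightarrow> int" where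
  "row_ind i r = (if int d dvd r - i then 1 else 0)"

lemma row_class_iff: "(\<exists>k::int. r = i + k * int d) \<longleftrightarrow> int d dvd r - i"
  unfolding dvd_def by (metis add_diff_cancel_left' diff_add_cancel mult.commute)

lemma row_ind_nonneg: "0 \<le> row_ind i r" and row_ind_le_1: "row_ind i r \<le> 1"
  and row_ind_self [simp]: "row_ind i i = 1"
  by (auto simp: row_ind_def)

lemma row_ind_shift: "row_ind (i + 1) (r + 1) = row_ind i r"
  by (simp add: row_ind_def)

lemma row_ind_shift': "row_ind (i + 1) r = row_ind i (r - 1)"
  by (simp add: row_ind_def algebra_simps)

lemma row_ind_period [simp]: "row_ind i (r + int d) = row_ind i r"
proof -
  have "int d dvd (r - i) + int d \<longleftrightarrow> int d dvd r - i" by (rule dvd_add_triv_right_iff)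
  then show ?thesis by (simp add: row_ind_def algebra_simps)
qed

lemma row_ind_disjoint:
  assumes "row_ind i \<noteq> row_ind j"
  shows "row_ind i r = 0 \<or> row_ind j r = 0"
proof (rule ccontr)
  assume "\<not> ?thesis"
  then have *: "int d dvd r - i" "int d dvd r - j" by (auto simp: row_ind_def split: if_splits)
  have "int d dvd (r - i) - (r - j)" using * by (rule dvd_diff)
  then have ij: "int d dvd j - i" by simp
  have "int d dvd s - i \<longleftrightarrow> int d dvd s - j" for s
    using dvd_add_right_iff[OF ij, of "s - j"] by simp
  then have "row_ind i = row_ind j" by (auto simp: row_ind_def)
  with assms show False ..
qed

lemma shape_iff:
  "\<nu> \<in> \<Lambda> \<longleftrightarrow> (\<forall>r. \<nu> (r + 1) \<le> \<nu> r) \<and> (\<forall>r. \<nu> r = \<nu> (r + int d) + int L)"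
proof -
  have "antimono \<nu>" if step: "\<forall>r. \<nu> (r + 1) \<le> \<nu> r"
  proof (rule antimonoI)
    fix x y :: int assume "x \<le> y"
    then show "\<nu> y \<le> \<nu> x"
    proof (induction rule: int_ge_induct)
      case (step i)
      then show ?case using that order_trans by blast
    qed simp
  qed
  moreover have "\<forall>r. \<nu> (r + 1) \<le> \<nu> r" if "antimono \<nu>"
    using that by (simp add: antimono_def)
  ultimately show ?thesis unfolding cyl_shapes_def by blast
qed

lemma shape_step: "\<nu> \<in> \<Lambda> \<Longrightarrow> \<nu> (r + 1) \<le> \<nu> r"
  using shape_iff by blast

lemma shape_period:
  assumes "\<nu> \<in> \<Lambda>"
  shows "\<nu> (r + int d) = \<nu> r - int L"
proof -
  have "\<nu> r = \<nu> (r + int d) + int L" using assms unfolding cyl_shapes_def by blast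
  then show ?thesis by linarith
qed

lemma shape_periods:
  fixes k :: int
  assumes "\<nu> \<in> \<Lambda>"
  shows "\<nu> (r + k * int d) = \<nu> r - k * int L"
proof (induction k rule: int_induct[where k = 0])
  case (step1 k)
  then show ?case using shape_period[OF assms, of "r + k * int d"] by (simp add: algebra_simps)
next
  case (step2 k)
  then show ?case using shape_period[OF assms, of "r + (k - 1) * int d"]
    by (simp add: algebra_simps)
qed simp

lemma adds_in_row_iff:
  "adds_cell_in_row d L i \<mu> \<nu> \<longleftrightarrow> \<mu> \<in> \<Lambda> \<and> \<nu> \<in> \<Lambda> \<and> \<nu> = (\<lambda>r. \<mu> r + row_ind i r)"
  unfolding adds_cell_in_row_def row_class_iff row_ind_def by (auto simp: fun_eq_iff)

lemma removes_cell_iff: "removes_cell d L \<nu> \<mu> \<longleftrightarrow> \<mu> \<lessdot> \<nu>"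
proof -
  have iff: "(\<forall>r. \<mu> r = (if P r then \<nu> r - 1 else \<nu> r)) \<longleftrightarrow> (\<forall>r. \<nu> r = (if P r then \<mu> r + 1 else \<mu> r))"
    for P :: "int \<Rightarrow> bool"
    by (intro all_cong1) auto
  then show ?thesis
    unfolding removes_cell_def adds_cell_def removes_cell_in_row_def adds_cell_in_row_def
    by (simp only: iff) blast
qed

lemma covered_shapes: "\<mu> \<lessdot> \<nu> \<Longrightarrow> \<mu> \<in> \<Lambda> \<and> \<nu> \<in> \<Lambda>"
  by (auto simp: adds_cell_def adds_in_row_iff)

lemma covered_iff: "\<mu> \<lessdot> \<nu> \<longleftrightarrow> \<mu> \<in> \<Lambda> \<and> \<nu> \<in> \<Lambda> \<and> (\<exists>i. \<nu> = (\<lambda>r. \<mu> r + row_ind i r))"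
  by (auto simp: adds_cell_def adds_in_row_iff)

lemma coveredI:
  "\<mu> \<in> \<Lambda> \<Longrightarrow> \<nu> \<in> \<Lambda> \<Longrightarrow> (\<And>r. \<nu> r = \<mu> r + row_ind i r) \<Longrightarrow> \<mu> \<lessdot> \<nu>"
  by (auto simp: covered_iff fun_eq_iff)

text \<open>Only the step from row \<open>i - 1\<close> to row \<open>i\<close>, up to periodicity, can break when a cell is added to
  row \<open>i\<close>. For \<open>d = 1\<close> the two rows move together and nothing can break; then the right-hand side
  is true because consecutive rows differ by \<open>L > 0\<close>.\<close>

lemma addable_iff:
  assumes "\<mu> \<in> \<Lambda>"
  shows "(\<lambda>r. \<mu> r + row_ind i r) \<in> \<Lambda> \<longleftrightarrow> \<mu> i < \<mu> (i - 1)"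
proof
  assume *: "(\<lambda>r. \<mu> r + row_ind i r) \<in> \<Lambda>"
  show "\<mu> i < \<mu> (i - 1)"
  proof (cases "d = 1")
    case True
    then show ?thesis using shape_period[OF assms, of "i - 1"] L_pos by simp
  next
    case False
    then have "row_ind i (i - 1) = 0" using d_pos by (auto simp: row_ind_def)
    then show ?thesis using shape_step[OF *, of "i - 1"] by simp
  qed
next
  assume less: "\<mu> i < \<mu> (i - 1)"
  have "\<mu> (r + 1) + row_ind i (r + 1) \<le> \<mu> r + row_ind i r" for r
  proof (cases "int d dvd r + 1 - i")
    case True
    then obtain k where r: "r + 1 = i + k * int d" using row_class_iff by blast
    then have r': "r = i - 1 + k * int d" by simp
    have "\<mu> (r + 1) = \<mu> i - k * int L" "\<mu> r = \<mu> (i - 1) - k * int L"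
      using shape_periods[OF assms, of i k] shape_periods[OF assms, of "i - 1" k]
      by (simp_all only: r r'[symmetric])
    then show ?thesis using less row_ind_le_1[of i "r + 1"] row_ind_nonneg[of i r] by linarith
  next
    case False
    then have "row_ind i (r + 1) = 0" by (simp add: row_ind_def)
    then show ?thesis using shape_step[OF assms, of r] row_ind_nonneg[of i r] by linarith
  qed
  then show "(\<lambda>r. \<mu> r + row_ind i r) \<in> \<Lambda>"
    using shape_period[OF assms] by (simp add: shape_iff)
qed

lemma removable_iff:
  assumes "\<nu> \<in> \<Lambda>"
  shows "(\<lambda>r. \<nu> r - row_ind i r) \<in> \<Lambda> \<longleftrightarrow> \<nu> (i + 1) < \<nu> i"
proof
  assume *: "(\<lambda>r. \<nu> r - row_ind i r) \<in> \<Lambda>"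
  show "\<nu> (i + 1) < \<nu> i"
  proof (cases "d = 1")
    case True
    then show ?thesis using shape_period[OF assms, of i] L_pos by simp
  next
    case False
    then have "row_ind i (i + 1) = 0" using d_pos by (auto simp: row_ind_def)
    then show ?thesis using shape_step[OF *, of i] by simp
  qed
next
  assume less: "\<nu> (i + 1) < \<nu> i"
  have "\<nu> (r + 1) - row_ind i (r + 1) \<le> \<nu> r - row_ind i r" for r
  proof (cases "int d dvd r - i")
    case True
    then obtain k where "r = i + k * int d" using row_class_iff by blast
    then have "\<nu> r = \<nu> i - k * int L" "\<nu> (r + 1) = \<nu> (i + 1) - k * int L"
      using shape_periods[OF assms, of i k] shape_periods[OF assms, of "i + 1" k]
      by (simp_all add: algebra_simps)
    then show ?thesis using less row_ind_le_1[of i r] row_ind_nonneg[of i "r + 1"] by linarith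
  next
    case False
    then have "row_ind i r = 0" by (simp add: row_ind_def)
    then show ?thesis using shape_step[OF assms, of r] row_ind_nonneg[of i "r + 1"] by linarith
  qed
  then show "(\<lambda>r. \<nu> r - row_ind i r) \<in> \<Lambda>"
    using shape_period[OF assms] by (simp add: shape_iff)
qed

text \<open>The reason why the degenerate local rule makes sense: a cell can be added to row \<open>i + 1\<close> and
  a cell can be removed from row \<open>i\<close> under the same condition, namely that the two rows differ in
  length.\<close>

lemma addable_below_removable:
  assumes "\<nu> \<in> \<Lambda>"
  shows "(\<lambda>r. \<nu> r + row_ind (i + 1) r) \<in> \<Lambda> \<longleftrightarrow> (\<lambda>r. \<nu> r - row_ind i r) \<in> \<Lambda>"
  using addable_iff[OF assms, of "i + 1"] removable_iff[OF assms, of i] by simp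

section \<open>The local rules\<close>

definition up :: "(int \<Rightarrow> int) \<Rightarrow> (int \<Rightarrow> int) set" where
  "up \<alpha> = {\<beta>. \<alpha> \<lessdot> \<beta>}"

definition down :: "(int \<Rightarrow> int) \<Rightarrow> (int \<Rightarrow> int) set" where
  "down \<alpha> = {\<beta>. \<beta> \<lessdot> \<alpha>}"

lemma row_ind_mod: "row_ind (i mod int d) = row_ind i"
proof -
  have "int d dvd i - i mod int d" by (simp add: minus_mod_eq_mult_div)
  then have "int d dvd (r - i) + (i - i mod int d) \<longleftrightarrow> int d dvd r - i" for r
    by (rule dvd_add_left_iff)
  then show ?thesis by (auto simp: row_ind_def)
qed

lemma row_ind_residue: "\<exists>j \<in> {0..<int d}. row_ind i = row_ind j"
  using row_ind_mod[of i] d_pos by (intro bexI[of _ "i mod int d"]) auto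

lemma finite_up: "finite (up \<alpha>)"
proof (rule finite_subset)
  show "up \<alpha> \<subseteq> (\<lambda>i r. \<alpha> r + row_ind i r) ` {0..<int d}"
  proof
    fix \<beta> assume "\<beta> \<in> up \<alpha>"
    then obtain i where "\<beta> = (\<lambda>r. \<alpha> r + row_ind i r)" by (auto simp: up_def covered_iff)
    then show "\<beta> \<in> (\<lambda>i r. \<alpha> r + row_ind i r) ` {0..<int d}"
      using row_ind_residue[of i] by auto
  qed
qed simp

lemma finite_down: "finite (down \<alpha>)"
proof (rule finite_subset)
  show "down \<alpha> \<subseteq> (\<lambda>i r. \<alpha> r - row_ind i r) ` {0..<int d}"
  proof
    fix \<beta> assume "\<beta> \<in> down \<alpha>"
    then obtain i where "\<alpha> = (\<lambda>r. \<beta> r + row_ind i r)" by (auto simp: down_def covered_iff)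
    then have "\<beta> = (\<lambda>r. \<alpha> r - row_ind i r)" by auto
    then show "\<beta> \<in> (\<lambda>i r. \<alpha> r - row_ind i r) ` {0..<int d}"
      using row_ind_residue[of i] by auto
  qed
qed simp

text \<open>If \<open>\<alpha>\<close> is \<open>\<beta>\<close> with a cell added to row \<open>i\<close>, then \<open>move_below \<alpha> \<beta>\<close> is \<open>\<alpha>\<close> with a cell added to
  row \<open>i + 1\<close>: the difference \<open>\<alpha> - \<beta>\<close> is the indicator of row \<open>i\<close>, and its shift by one is that of
  row \<open>i + 1\<close>. The formulas do not mention \<open>i\<close>, which makes it evident that the two moves are inverse
  to each other.\<close>

definition move_below :: "(int \<Rightarrow> int) \<Rightarrow> (int \<Rightarrow> int) \<Rightarrow> int \<Rightarrow> int" where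
  "move_below \<alpha> \<beta> = (\<lambda>r. \<alpha> r + (\<alpha> (r - 1) - \<beta> (r - 1)))"

definition move_above :: "(int \<Rightarrow> int) \<Rightarrow> (int \<Rightarrow> int) \<Rightarrow> int \<Rightarrow> int" where
  "move_above \<alpha> \<beta> = (\<lambda>r. \<alpha> r - (\<beta> (r + 1) - \<alpha> (r + 1)))"

lemma move_above_below [simp]: "move_above \<alpha> (move_below \<alpha> \<beta>) = \<beta>"
  and move_below_above [simp]: "move_below \<alpha> (move_above \<alpha> \<beta>) = \<beta>"
  by (simp_all add: move_above_def move_below_def)

lemma move_below_row:
  assumes "adds_cell_in_row d L i \<beta> \<alpha>"
  shows "adds_cell_in_row d L (i + 1) \<alpha> (move_below \<alpha> \<beta>)"
proof -
  have \<alpha>: "\<alpha> \<in> \<Lambda>" "\<beta> \<in> \<Lambda>" "\<alpha> = (\<lambda>r. \<beta> r + row_ind i r)"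
    using assms by (auto simp: adds_in_row_iff)
  have "move_below \<alpha> \<beta> = (\<lambda>r. \<alpha> r + row_ind (i + 1) r)"
    by (simp add: move_below_def row_ind_shift' \<alpha>(3))
  moreover have "(\<lambda>r. \<alpha> r - row_ind i r) = \<beta>" by (simp add: \<alpha>(3))
  ultimately show ?thesis
    using \<alpha> addable_below_removable[OF \<alpha>(1), of i] by (simp add: adds_in_row_iff)
qed

lemma move_below: "\<beta> \<lessdot> \<alpha> \<Longrightarrow> \<alpha> \<lessdot> move_below \<alpha> \<beta>"
  using move_below_row unfolding adds_cell_def by blast

lemma move_above:
  assumes "\<alpha> \<lessdot> \<beta>"
  shows "move_above \<alpha> \<beta> \<lessdot> \<alpha>"
proof -
  obtain j where \<alpha>: "\<alpha> \<in> \<Lambda>" "\<beta> \<in> \<Lambda>" "\<beta> = (\<lambda>r. \<alpha> r + row_ind j r)"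
    using assms by (auto simp: covered_iff)
  define i where "i = j - 1"
  have \<beta>: "\<beta> = (\<lambda>r. \<alpha> r + row_ind (i + 1) r)" using \<alpha>(3) by (simp add: i_def)
  have m: "move_above \<alpha> \<beta> = (\<lambda>r. \<alpha> r - row_ind i r)"
    by (simp add: move_above_def \<beta> row_ind_shift)
  then have "move_above \<alpha> \<beta> \<in> \<Lambda>"
    using addable_below_removable[OF \<alpha>(1), of i] \<alpha>(2) \<beta> by simp
  then show ?thesis using \<alpha>(1) m by (intro coveredI[of _ _ i]) auto
qed

lemma max_shape: "\<alpha> \<in> \<Lambda> \<Longrightarrow> \<gamma> \<in> \<Lambda> \<Longrightarrow> (\<lambda>r. max (\<alpha> r) (\<gamma> r)) \<in> \<Lambda>"
  unfolding shape_iff by (smt (verit))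

lemma min_shape: "\<alpha> \<in> \<Lambda> \<Longrightarrow> \<gamma> \<in> \<Lambda> \<Longrightarrow> (\<lambda>r. min (\<alpha> r) (\<gamma> r)) \<in> \<Lambda>"
  unfolding shape_iff by (smt (verit))

text \<open>Two distinct shapes with a common lower neighbour arise from it by adding cells to rows in
  different residue classes, so adding both cells gives the pointwise maximum, and the common lower
  neighbour is the pointwise minimum.\<close>

lemma diamond_up:
  assumes "\<beta> \<lessdot> \<alpha>" "\<beta> \<lessdot> \<gamma>" "\<alpha> \<noteq> \<gamma>"
  shows "\<alpha> \<lessdot> (\<lambda>r. max (\<alpha> r) (\<gamma> r))" and "(\<lambda>r. min (\<alpha> r) (\<gamma> r)) = \<beta>"
proof -
  obtain i j where *: "\<alpha> \<in> \<Lambda>" "\<gamma> \<in> \<Lambda>" "\<alpha> = (\<lambda>r. \<beta> r + row_ind i r)"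
    "\<gamma> = (\<lambda>r. \<beta> r + row_ind j r)"
    using assms by (auto simp: covered_iff)
  have ij: "row_ind i r = 0 \<or> row_ind j r = 0" for r
    using assms(3) * row_ind_disjoint[of i j r] by force
  have nn: "0 \<le> row_ind i r" "0 \<le> row_ind j r" for r by (simp_all add: row_ind_nonneg)
  have "max (\<alpha> r) (\<gamma> r) = \<alpha> r + row_ind j r" for r
    using ij[of r] nn[of r] by (auto simp: *(3,4))
  then show "\<alpha> \<lessdot> (\<lambda>r. max (\<alpha> r) (\<gamma> r))"
    using *(1,2) max_shape[OF *(1,2)] by (intro coveredI[of _ _ j]) simp_all
  show "(\<lambda>r. min (\<alpha> r) (\<gamma> r)) = \<beta>"
  proof
    fix r show "min (\<alpha> r) (\<gamma> r) = \<beta> r"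
      using ij[of r] nn[of r] by (auto simp: *(3,4))
  qed
qed

lemma diamond_down:
  assumes "\<alpha> \<lessdot> \<beta>" "\<gamma> \<lessdot> \<beta>" "\<alpha> \<noteq> \<gamma>"
  shows "(\<lambda>r. min (\<alpha> r) (\<gamma> r)) \<lessdot> \<alpha>" and "(\<lambda>r. max (\<alpha> r) (\<gamma> r)) = \<beta>"
proof -
  obtain i j where *: "\<alpha> \<in> \<Lambda>" "\<gamma> \<in> \<Lambda>" "\<beta> = (\<lambda>r. \<alpha> r + row_ind i r)"
    "\<beta> = (\<lambda>r. \<gamma> r + row_ind j r)"
    using assms by (auto simp: covered_iff)
  have eq: "\<alpha> r + row_ind i r = \<gamma> r + row_ind j r" "\<beta> r = \<alpha> r + row_ind i r" for r
    using fun_cong[OF *(3), of r] fun_cong[OF *(4), of r] by auto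
  have "row_ind i \<noteq> row_ind j"
  proof
    assume "row_ind i = row_ind j"
    then have "\<alpha> = \<gamma>" using eq(1) by (intro ext) (metis add_right_cancel)
    with assms(3) show False ..
  qed
  then have ij: "row_ind i r = 0 \<or> row_ind j r = 0" for r by (rule row_ind_disjoint)
  have nn: "0 \<le> row_ind i r" "0 \<le> row_ind j r" for r by (simp_all add: row_ind_nonneg)
  have "\<alpha> r = min (\<alpha> r) (\<gamma> r) + row_ind j r" for r
    using ij[of r] nn[of r] eq[of r] by linarith
  then show "(\<lambda>r. min (\<alpha> r) (\<gamma> r)) \<lessdot> \<alpha>"
    using * min_shape by (intro coveredI[of _ _ j]) auto
  show "(\<lambda>r. max (\<alpha> r) (\<gamma> r)) = \<beta>"
  proof
    fix r show "max (\<alpha> r) (\<gamma> r) = \<beta> r"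
      using ij[of r] nn[of r] eq[of r] by linarith
  qed
qed

text \<open>The local rule and its inverse, as functions that complete a square from three of its corners.\<close>

definition upper_corner ::
    "(int \<Rightarrow> int) \<Rightarrow> (int \<Rightarrow> int) \<Rightarrow> (int \<Rightarrow> int) \<Rightarrow> int \<Rightarrow> int" where
  "upper_corner LL UL LR =
     (if UL = LR then move_below UL LL else (\<lambda>r. max (UL r) (LR r)))"

definition lower_corner ::
    "(int \<Rightarrow> int) \<Rightarrow> (int \<Rightarrow> int) \<Rightarrow> (int \<Rightarrow> int) \<Rightarrow> int \<Rightarrow> int" where
  "lower_corner UR UL LR =
     (if UL = LR then move_above UL UR else (\<lambda>r. min (UL r) (LR r)))"

lemma upper_corner_commute: "upper_corner LL UL LR = upper_corner LL LR UL"
  by (auto simp: upper_corner_def max.commute)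

lemma lower_corner_commute: "lower_corner UR UL LR = lower_corner UR LR UL"
  by (auto simp: lower_corner_def min.commute)

lemma upper_corner_covers:
  "LL \<lessdot> UL \<Longrightarrow> LL \<lessdot> LR \<Longrightarrow> UL \<lessdot> upper_corner LL UL LR"
  using diamond_up(1) move_below by (auto simp: upper_corner_def)

lemma lower_corner_covered:
  "UL \<lessdot> UR \<Longrightarrow> LR \<lessdot> UR \<Longrightarrow> lower_corner UR UL LR \<lessdot> UL"
  using diamond_down(1) move_above by (auto simp: lower_corner_def)

lemma lower_upper_corner:
  "LL \<lessdot> UL \<Longrightarrow> LL \<lessdot> LR \<Longrightarrow> lower_corner (upper_corner LL UL LR) UL LR = LL"
  using diamond_up(2) by (auto simp: upper_corner_def lower_corner_def)

lemma upper_lower_corner: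
  "UL \<lessdot> UR \<Longrightarrow> LR \<lessdot> UR \<Longrightarrow> upper_corner (lower_corner UR UL LR) UL LR = UR"
  using diamond_down(2) by (auto simp: upper_corner_def lower_corner_def)

lemma forward_rule_iff:
  assumes "LL \<lessdot> UL" "LL \<lessdot> LR"
  shows "forward_rule d L LL UL LR UR \<longleftrightarrow> UR = upper_corner LL UL LR"
proof (cases "UL = LR")
  case False
  then show ?thesis by (auto simp: forward_rule_def upper_corner_def)
next
  case True
  obtain i where i: "adds_cell_in_row d L i LL UL" using assms by (auto simp: adds_cell_def)
  have "UR = move_below UL LL" if "adds_cell_in_row d L (i + 1) UL UR"
    using that move_below_row[OF i] by (simp add: adds_in_row_iff)
  then show ?thesis using True i move_below_row
    by (auto simp: forward_rule_def upper_corner_def)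
qed

section \<open>Commuting operators\<close>

definition U :: "((int \<Rightarrow> int) \<Rightarrow> nat) \<Rightarrow> (int \<Rightarrow> int) \<Rightarrow> nat" where
  "U f \<alpha> = (\<Sum>\<beta>\<in>up \<alpha>. f \<beta>)"

definition D :: "((int \<Rightarrow> int) \<Rightarrow> nat) \<Rightarrow> (int \<Rightarrow> int) \<Rightarrow> nat" where
  "D f \<alpha> = (\<Sum>\<beta>\<in>down \<alpha>. f \<beta>)"

lemma U_one_eq_D_one: "U (\<lambda>_. 1) = D (\<lambda>_. 1)"
proof
  fix \<alpha>
  have "bij_betw (move_above \<alpha>) (up \<alpha>) (down \<alpha>)"
    by (rule bij_betw_byWitness[where f' = "move_below \<alpha>"])
      (auto simp: up_def down_def move_above move_below)
  then show "U (\<lambda>_. 1) \<alpha> = D (\<lambda>_. 1) \<alpha>"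
    by (simp add: U_def D_def bij_betw_same_card)
qed

text \<open>Completing squares exchanges the peaks above \<open>\<alpha>\<close> and \<open>\<gamma>\<close> with the valleys below them, for each
  fixed \<open>\<gamma>\<close>. The case \<open>\<gamma> = \<alpha>\<close> is the degenerate rule.\<close>

lemma U_D_commute: "U (D f) = D (U f)"
proof
  fix \<alpha>
  have down_up: "lower_corner \<beta> \<alpha> \<gamma> \<lessdot> \<alpha> \<and> lower_corner \<beta> \<alpha> \<gamma> \<lessdot> \<gamma> \<and>
      upper_corner (lower_corner \<beta> \<alpha> \<gamma>) \<alpha> \<gamma> = \<beta>" if "\<alpha> \<lessdot> \<beta>" "\<gamma> \<lessdot> \<beta>" for \<beta> \<gamma>
    using that lower_corner_covered upper_lower_corner lower_corner_commute by metis
  have up_down: "\<alpha> \<lessdot> upper_corner \<beta> \<alpha> \<gamma> \<and> \<gamma> \<lessdot> upper_corner \<beta> \<alpha> \<gamma> \<and>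
      lower_corner (upper_corner \<beta> \<alpha> \<gamma>) \<alpha> \<gamma> = \<beta>" if "\<beta> \<lessdot> \<alpha>" "\<beta> \<lessdot> \<gamma>" for \<beta> \<gamma>
    using that upper_corner_covers lower_upper_corner upper_corner_commute by metis
  have "U (D f) \<alpha> = (\<Sum>(\<beta>, \<gamma>)\<in>(SIGMA \<beta>:up \<alpha>. down \<beta>). f \<gamma>)"
    unfolding U_def D_def by (rule sum.Sigma) (auto simp: finite_up finite_down)
  also have "\<dots> = (\<Sum>(\<beta>, \<gamma>)\<in>(SIGMA \<beta>:down \<alpha>. up \<beta>). f \<gamma>)"
    by (rule sum.reindex_bij_witness[where
          i = "\<lambda>(\<beta>, \<gamma>). (upper_corner \<beta> \<alpha> \<gamma>, \<gamma>)" and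
          j = "\<lambda>(\<beta>, \<gamma>). (lower_corner \<beta> \<alpha> \<gamma>, \<gamma>)"])
      (auto simp: up_def down_def down_up up_down)
  also have "\<dots> = D (U f) \<alpha>"
    unfolding U_def D_def by (rule sum.Sigma[symmetric]) (auto simp: finite_up finite_down)
  finally show "U (D f) \<alpha> = D (U f) \<alpha>" .
qed

lemma U_D_power: "U ((D ^^ n) f) = (D ^^ n) (U f)"
  by (induction n) (simp_all add: U_D_commute)

fun step_op :: "sign \<Rightarrow> ((int \<Rightarrow> int) \<Rightarrow> nat) \<Rightarrow> (int \<Rightarrow> int) \<Rightarrow> nat" where
  "step_op Plus = U"
| "step_op Minus = D"

text \<open>The letters of a word are absorbed from the right: a letter plus in front of \<open>D\<^sup>n 1\<close> commutes past
  the power and becomes \<open>D\<close> on the constant \<open>1\<close>.\<close>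

lemma word_op_eq: "foldr step_op w (\<lambda>_. 1) = (D ^^ length w) (\<lambda>_. 1)"
proof (induction w)
  case (Cons s w)
  then show ?case
    by (cases s) (simp_all add: U_D_power U_one_eq_D_one funpow_swap1 del: One_nat_def)
qed simp

section \<open>Oscillating tableaux\<close>

fun steps :: "sign \<Rightarrow> (int \<Rightarrow> int) \<Rightarrow> (int \<Rightarrow> int) set" where
  "steps Plus \<alpha> = up \<alpha>"
| "steps Minus \<alpha> = down \<alpha>"

lemma step_op_eq: "step_op s f \<alpha> = (\<Sum>\<beta>\<in>steps s \<alpha>. f \<beta>)"
  by (cases s) (simp_all add: U_def D_def)

lemma finite_steps: "finite (steps s \<alpha>)"
  by (cases s) (simp_all add: finite_up finite_down)

lemma steps_shapes: "\<beta> \<in> steps s \<alpha> \<Longrightarrow> \<beta> \<in> \<Lambda>"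
  by (cases s) (auto simp: up_def down_def dest: covered_shapes)

lemma OCT_iff:
  "\<rho> \<in> OCT d L w \<alpha> \<longleftrightarrow> length \<rho> = length w + 1 \<and> set \<rho> \<subseteq> \<Lambda> \<and> \<rho> ! 0 = \<alpha> \<and>
     (\<forall>k < length w. \<rho> ! (k + 1) \<in> steps (w ! k) (\<rho> ! k))"
proof -
  have "(case s of Plus \<Rightarrow> adds_cell d L \<mu> \<nu> | Minus \<Rightarrow> removes_cell d L \<mu> \<nu>)
      \<longleftrightarrow> \<nu> \<in> steps s \<mu>" for s \<mu> \<nu>
    by (cases s) (auto simp: up_def down_def removes_cell_iff)
  then show ?thesis by (simp add: OCT_def)
qed

lemma OCT_Nil: "\<alpha> \<in> \<Lambda> \<Longrightarrow> OCT d L [] \<alpha> = {[\<alpha>]}"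
  by (auto simp: OCT_iff length_Suc_conv)

lemma OCT_Cons:
  assumes "\<alpha> \<in> \<Lambda>"
  shows "OCT d L (s # w) \<alpha> = (\<Union>\<beta>\<in>steps s \<alpha>. (#) \<alpha> ` OCT d L w \<beta>)"
proof (rule set_eqI)
  fix \<rho>
  show "\<rho> \<in> OCT d L (s # w) \<alpha> \<longleftrightarrow> \<rho> \<in> (\<Union>\<beta>\<in>steps s \<alpha>. (#) \<alpha> ` OCT d L w \<beta>)"
  proof (cases \<rho>)
    case Nil
    then show ?thesis by (auto simp: OCT_iff)
  next
    case (Cons a \<sigma>)
    have "(\<rho> \<in> OCT d L (s # w) \<alpha>) \<longleftrightarrow> a = \<alpha> \<and> \<sigma> ! 0 \<in> steps s \<alpha> \<and> \<sigma> \<in> OCT d L w (\<sigma> ! 0)"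
      using assms by (auto simp: OCT_iff Cons All_less_Suc2)
    also have "\<dots> \<longleftrightarrow> \<rho> \<in> (\<Union>\<beta>\<in>steps s \<alpha>. (#) \<alpha> ` OCT d L w \<beta>)"
    proof
      assume R: "a = \<alpha> \<and> \<sigma> ! 0 \<in> steps s \<alpha> \<and> \<sigma> \<in> OCT d L w (\<sigma> ! 0)"
      then show "\<rho> \<in> (\<Union>\<beta>\<in>steps s \<alpha>. (#) \<alpha> ` OCT d L w \<beta>)"
        by (intro UN_I[of "\<sigma> ! 0"]) (simp_all add: Cons)
    next
      assume "\<rho> \<in> (\<Union>\<beta>\<in>steps s \<alpha>. (#) \<alpha> ` OCT d L w \<beta>)"
      then obtain \<beta> where "\<beta> \<in> steps s \<alpha>" "a = \<alpha>" "\<sigma> \<in> OCT d L w \<beta>" using Cons by auto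
      moreover from this have "\<sigma> ! 0 = \<beta>" by (simp add: OCT_iff)
      ultimately show "a = \<alpha> \<and> \<sigma> ! 0 \<in> steps s \<alpha> \<and> \<sigma> \<in> OCT d L w (\<sigma> ! 0)" by simp
    qed
    finally show ?thesis .
  qed
qed

text \<open>An oscillating tableau is its first shape followed by one that starts at a neighbour of it.\<close>

lemma card_OCT:
  assumes "\<alpha> \<in> \<Lambda>"
  shows "finite (OCT d L w \<alpha>) \<and> card (OCT d L w \<alpha>) = foldr step_op w (\<lambda>_. 1) \<alpha>"
  using assms
proof (induction w arbitrary: \<alpha>)
  case Nil
  then show ?case by (simp add: OCT_Nil)
next
  case (Cons s w)
  have IH: "finite (OCT d L w \<beta>)" "card (OCT d L w \<beta>) = foldr step_op w (\<lambda>_. 1) \<beta>"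
    if "\<beta> \<in> steps s \<alpha>" for \<beta>
    using Cons.IH[OF steps_shapes[OF that]] by auto
  have "card (\<Union>\<beta>\<in>steps s \<alpha>. (#) \<alpha> ` OCT d L w \<beta>)
      = (\<Sum>\<beta>\<in>steps s \<alpha>. card ((#) \<alpha> ` OCT d L w \<beta>))"
    by (rule card_UN_disjoint) (auto simp: finite_steps IH OCT_iff)
  also have "\<dots> = foldr step_op (s # w) (\<lambda>_. 1) \<alpha>"
    by (simp add: step_op_eq card_image IH)
  finally show ?case
    using IH by (simp add: OCT_Cons[OF Cons.prems] finite_steps)
qed

section \<open>Symmetric growth diagrams\<close>

text \<open>The labelling of the quadrant whose left and bottom edges both carry the sequence \<open>a\<close>, filled in
  by the local rule.\<close>

fun grow :: "(nat \<Rightarrow> int \<Rightarrow> int) \<Rightarrow> nat \<Rightarrow> nat \<Rightarrow> int \<Rightarrow> int" where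
  "grow a 0 y = a y"
| "grow a (Suc x) 0 = a (Suc x)"
| "grow a (Suc x) (Suc y) =
     upper_corner (grow a x y) (grow a x (Suc y)) (grow a (Suc x) y)"

lemma grow_boundary: "grow a x 0 = a x"
  by (cases x) simp_all

lemma grow_commute: "grow a x y = grow a y x"
proof (induction a x y rule: grow.induct)
  case (3 a x y)
  then show ?case by (simp add: upper_corner_commute)
qed (simp_all add: grow_boundary)

text \<open>Edges propagate from square to square. A horizontal edge is a vertical edge reflected in the
  diagonal, so by \<open>grow_commute\<close> an induction on \<open>x + y\<close> over vertical edges alone suffices.\<close>

lemma grow_vertical:
  assumes "\<And>y. y < n \<Longrightarrow> a y \<lessdot> a (Suc y)"
  shows "x \<le> n \<Longrightarrow> y < n \<Longrightarrow> grow a x y \<lessdot> grow a x (Suc y)"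
proof (induction "x + y" arbitrary: x y rule: less_induct)
  case less
  show ?case
  proof (cases x)
    case 0
    then show ?thesis using assms less.prems by simp
  next
    case (Suc x')
    have V: "grow a x' y \<lessdot> grow a x' (Suc y)" using less Suc by simp
    have H: "grow a x' y \<lessdot> grow a x y"
    proof -
      have "grow a y x' \<lessdot> grow a y (Suc x')" using less Suc by simp
      then show ?thesis using grow_commute Suc by metis
    qed
    show ?thesis
      using upper_corner_covers[OF H V] by (simp add: Suc upper_corner_commute)
  qed
qed

lemma symmetric_growth_eq_grow:
  assumes "\<rho> \<in> symmetric_growth_diagrams d L n"
  shows "x \<le> n \<Longrightarrow> y \<le> n \<Longrightarrow> \<rho> (x, y) = grow (\<lambda>y. \<rho> (0, y)) x y"
proof (induction "\<lambda>y. \<rho> (0, y)" x y rule: grow.induct)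
  case (2 x)
  then show ?case using assms by (auto simp: symmetric_growth_diagrams_def)
next
  case (3 x y)
  have H: "\<rho> (x, y) \<lessdot> \<rho> (Suc x, y)" and V: "\<rho> (x, y) \<lessdot> \<rho> (x, Suc y)"
    and "forward_rule d L (\<rho> (x, y)) (\<rho> (x, Suc y)) (\<rho> (Suc x, y)) (\<rho> (Suc x, Suc y))"
    using assms "3.prems" by (auto simp: symmetric_growth_diagrams_def growth_diagrams_def)
  then have "\<rho> (Suc x, Suc y) = upper_corner (\<rho> (x, y)) (\<rho> (x, Suc y)) (\<rho> (Suc x, y))"
    using forward_rule_iff[OF V H] by simp
  then show ?case using 3 by simp
qed simp

lemma grow_symmetric_growth:
  assumes shape: "a 0 \<in> \<Lambda>" and edge: "\<And>y. y < n \<Longrightarrow> a y \<lessdot> a (Suc y)"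
  shows "restrict (\<lambda>(x, y). grow a x y) ({0..n} \<times> {0..n}) \<in> symmetric_growth_diagrams d L n"
proof -
  have V: "grow a x y \<lessdot> grow a x (Suc y)" if "x \<le> n" "y < n" for x y
    by (rule grow_vertical[of n a]) (use edge that in auto)
  have H: "grow a x y \<lessdot> grow a (Suc x) y" if "x < n" "y \<le> n" for x y
    using V[OF that(2,1)] by (simp add: grow_commute[of a y])
  have "grow a x y \<in> \<Lambda>" if xy: "x \<le> n" "y \<le> n" for x y
  proof (cases "x = 0 \<and> y = 0")
    case True
    then show ?thesis using shape by simp
  next
    case False
    then consider x' where "x = Suc x'" | y' where "y = Suc y'" by (cases x; cases y) auto
    then show ?thesis
      by cases (use xy V H covered_shapes in \<open>meson Suc_le_lessD\<close>)+
  qed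
  moreover have "forward_rule d L (grow a x y) (grow a x (Suc y)) (grow a (Suc x) y)
      (grow a (Suc x) (Suc y))" if "x < n" "y < n" for x y
    using that by (simp add: forward_rule_iff H V)
  ultimately show ?thesis
    using H V grow_commute[of a]
    by (auto simp: symmetric_growth_diagrams_def growth_diagrams_def)
qed

text \<open>The left edge is read from the vertex \<open>(0, n)\<close> with label \<open>\<alpha>\<close> down to \<open>(0, 0)\<close>, so that its steps
  remove cells.\<close>

lemma restrict_left_edge_bij:
  "bij_betw (\<lambda>\<rho>. map (\<lambda>k. \<rho> (0, n - k)) [0..<Suc n])
     {\<rho> \<in> symmetric_growth_diagrams d L n. \<rho> (0, n) = \<alpha> \<and> \<rho> (n, 0) = \<alpha>}
     (OCT d L (replicate n Minus) \<alpha>)"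
  (is "bij_betw ?f ?A ?B")
proof (rule bij_betw_imageI)
  show "inj_on ?f ?A"
  proof (rule inj_onI)
    fix \<rho> \<sigma> assume \<rho>: "\<rho> \<in> ?A" and \<sigma>: "\<sigma> \<in> ?A" and eq: "?f \<rho> = ?f \<sigma>"
    have nth: "?f \<tau> ! (n - y) = \<tau> (0, y)" if "y \<le> n" for \<tau> :: "nat \<times> nat \<Rightarrow> int \<Rightarrow> int" and y
      using that by (subst nth_map_upt) auto
    have left: "\<rho> (0, y) = \<sigma> (0, y)" if "y \<le> n" for y
      using nth[OF that, of \<rho>] nth[OF that, of \<sigma>] eq by metis
    have "grow (\<lambda>y. \<rho> (0, y)) x y = grow (\<lambda>y. \<sigma> (0, y)) x y" if "x \<le> n" "y \<le> n" for x y
      using that by (induction "\<lambda>y. \<rho> (0, y)" x y rule: grow.induct) (simp_all add: left)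
    then have "\<rho> (x, y) = \<sigma> (x, y)" if "x \<le> n" "y \<le> n" for x y
      using symmetric_growth_eq_grow[of \<rho> n x y] symmetric_growth_eq_grow[of \<sigma> n x y] \<rho> \<sigma> that
      by simp
    moreover have "\<rho> \<in> extensional ({0..n} \<times> {0..n})" "\<sigma> \<in> extensional ({0..n} \<times> {0..n})"
      using \<rho> \<sigma> by (auto simp: symmetric_growth_diagrams_def growth_diagrams_def PiE_def)
    ultimately show "\<rho> = \<sigma>" by (intro extensionalityI[of \<rho> _ \<sigma>]) auto
  qed
next
  have "?f \<rho> \<in> ?B" if "\<rho> \<in> ?A" for \<rho>
  proof -
    have V: "\<rho> (0, y) \<lessdot> \<rho> (0, Suc y)" if "y < n" for y
      using \<open>\<rho> \<in> ?A\<close> that by (auto simp: symmetric_growth_diagrams_def growth_diagrams_def)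
    have S: "\<rho> (0, y) \<in> \<Lambda>" if "y \<le> n" for y
      using \<open>\<rho> \<in> ?A\<close> that by (auto simp: symmetric_growth_diagrams_def growth_diagrams_def)
    have "\<rho> (0, n - Suc k) \<lessdot> \<rho> (0, n - k)" if "k < n" for k
      using V[of "n - Suc k"] that by (simp add: Suc_diff_Suc)
    then show ?thesis
      using \<open>\<rho> \<in> ?A\<close> S by (auto simp: OCT_iff down_def nth_map_upt simp del: upt_Suc)
  qed
  moreover have "\<exists>\<rho> \<in> ?A. ?f \<rho> = l" if l: "l \<in> ?B" for l
  proof -
    define a where "a y = l ! (n - y)" for y
    have len: "length l = Suc n" and l0: "l ! 0 = \<alpha>"
      and sh: "\<And>k. k \<le> n \<Longrightarrow> l ! k \<in> \<Lambda>" and st: "\<And>k. k < n \<Longrightarrow> l ! Suc k \<lessdot> l ! k"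
      using l by (auto simp: OCT_iff down_def)
    have edge: "a y \<lessdot> a (Suc y)" if "y < n" for y
      using st[of "n - Suc y"] that by (simp add: a_def Suc_diff_Suc)
    define \<rho> where "\<rho> = restrict (\<lambda>(x, y). grow a x y) ({0..n} \<times> {0..n})"
    have "\<rho> \<in> symmetric_growth_diagrams d L n"
      unfolding \<rho>_def by (rule grow_symmetric_growth) (auto simp: a_def sh edge[unfolded a_def])
    moreover have "\<rho> (0, n) = \<alpha>" "\<rho> (n, 0) = \<alpha>"
      by (auto simp: \<rho>_def grow_boundary a_def l0)
    moreover have "?f \<rho> = l"
      by (rule nth_equalityI) (auto simp: len \<rho>_def a_def simp del: upt_Suc)
    ultimately show ?thesis by blast
  qed
  ultimately show "?f ` ?A = ?B" by blast
qed

section \<open>Cells\<close>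

lemma cell_eq: "cell d L i j = {(i - k * int d, j + k * int L) | k :: int. True}"
  by (auto simp: cell_def cyl_rel_def)

lemma cell_eq_iff:
  "cell d L i j = cell d L i' j' \<longleftrightarrow> (\<exists>k::int. i' = i - k * int d \<and> j' = j + k * int L)"
proof
  assume "cell d L i j = cell d L i' j'"
  moreover have "(i', j') \<in> cell d L i' j'" by (auto simp: cell_eq intro!: exI[of _ 0])
  ultimately have "(i', j') \<in> cell d L i j" by simp
  then show "\<exists>k::int. i' = i - k * int d \<and> j' = j + k * int L" by (auto simp: cell_eq)
next
  assume "\<exists>k::int. i' = i - k * int d \<and> j' = j + k * int L"
  then obtain k :: int where k: "i' = i - k * int d" "j' = j + k * int L" by blast
  have "(\<exists>l::int. x = i - l * int d \<and> y = j + l * int L) \<longleftrightarrow>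
      (\<exists>l::int. x = i' - l * int d \<and> y = j' + l * int L)" for x y
  proof
    assume "\<exists>l::int. x = i - l * int d \<and> y = j + l * int L"
    then obtain l :: int where "x = i - l * int d" "y = j + l * int L" by blast
    then show "\<exists>l::int. x = i' - l * int d \<and> y = j' + l * int L"
      by (intro exI[of _ "l - k"]) (simp add: k algebra_simps)
  next
    assume "\<exists>l::int. x = i' - l * int d \<and> y = j' + l * int L"
    then obtain l :: int where "x = i' - l * int d" "y = j' + l * int L" by blast
    then show "\<exists>l::int. x = i - l * int d \<and> y = j + l * int L"
      by (intro exI[of _ "l + k"]) (simp add: k algebra_simps)
  qed
  then show "cell d L i j = cell d L i' j'" by (auto simp: cell_eq)
qed

lemma cell_in_young_iff [simp]:
  assumes "\<nu> \<in> \<Lambda>"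
  shows "cell d L i j \<in> young_diagram d L \<nu> \<longleftrightarrow> j \<le> \<nu> i"
proof
  assume "cell d L i j \<in> young_diagram d L \<nu>"
  then obtain i' j' where "cell d L i j = cell d L i' j'" and j': "j' \<le> \<nu> i'"
    by (auto simp: young_diagram_def)
  then obtain k :: int where "i' = i - k * int d" "j' = j + k * int L"
    by (auto simp: cell_eq_iff)
  then show "j \<le> \<nu> i" using j' shape_periods[OF assms, of i "-k"] by simp
qed (auto simp: young_diagram_def)

lemma skew_cell_iff [simp]:
  assumes "\<nu> \<in> \<Lambda>" "\<mu> \<in> \<Lambda>"
  shows "cell d L i j \<in> skew_diagram d L \<nu> \<mu> \<longleftrightarrow> \<mu> i < j \<and> j \<le> \<nu> i"
  using assms by (auto simp: skew_diagram_def)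

lemma skew_cellE:
  assumes "c \<in> skew_diagram d L \<nu> \<mu>"
  obtains i j where "c = cell d L i j"
  using assms by (auto simp: skew_diagram_def young_diagram_def)

lemma young_diagram_mono: "(\<And>i. \<mu> i \<le> \<nu> i) \<Longrightarrow> young_diagram d L \<mu> \<subseteq> young_diagram d L \<nu>"
  unfolding young_diagram_def using order_trans by blast

lemma young_diagram_inj:
  assumes "\<mu> \<in> \<Lambda>" "\<nu> \<in> \<Lambda>" "young_diagram d L \<mu> = young_diagram d L \<nu>"
  shows "\<mu> = \<nu>"
proof
  fix i
  have "j \<le> \<mu> i \<longleftrightarrow> j \<le> \<nu> i" for j
    using assms cell_in_young_iff by metis
  then show "\<mu> i = \<nu> i" by (meson order_antisym order_refl)
qed

lemma covered_le: "\<beta> \<lessdot> \<nu> \<Longrightarrow> \<beta> i \<le> \<nu> i"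
  by (auto simp: covered_iff row_ind_nonneg)

lemma skew_adds_in_row:
  assumes "adds_cell_in_row d L i \<beta> \<nu>"
  shows "skew_diagram d L \<nu> \<beta> = {cell d L i (\<nu> i)}"
proof -
  have \<nu>: "\<nu> \<in> \<Lambda>" "\<beta> \<in> \<Lambda>" "\<And>r. \<nu> r = \<beta> r + row_ind i r"
    using assms by (auto simp: adds_in_row_iff)
  have "c = cell d L i (\<nu> i)" if c: "c \<in> skew_diagram d L \<nu> \<beta>" for c
  proof -
    obtain r j where c_eq: "c = cell d L r j" using c by (rule skew_cellE)
    with c \<nu> have "\<beta> r < j" "j \<le> \<beta> r + row_ind i r" by auto
    then have "row_ind i r \<noteq> 0" and j: "j = \<nu> r"
      using row_ind_le_1[of i r] by (auto simp: \<nu>(3))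
    then obtain k where r: "r = i + k * int d"
      using row_class_iff by (auto simp: row_ind_def split: if_splits)
    then show ?thesis
      unfolding c_eq cell_eq_iff using shape_periods[OF \<nu>(1), of i k]
      by (intro exI[of _ k]) (simp add: j)
  qed
  moreover have "cell d L i (\<nu> i) \<in> skew_diagram d L \<nu> \<beta>"
    using \<nu> by simp
  ultimately show ?thesis by blast
qed

text \<open>The cell by which \<open>\<nu>\<close> exceeds \<open>\<beta>\<close>; meaningful only for \<open>\<beta> \<lessdot> \<nu>\<close>, when the difference is a
  single cell.\<close>

definition new_cell :: "(int \<Rightarrow> int) \<Rightarrow> (int \<Rightarrow> int) \<Rightarrow> (int \<times> int) set" where
  "new_cell \<beta> \<nu> = the_elem (skew_diagram d L \<nu> \<beta>)"

lemma new_cell_in_row: "adds_cell_in_row d L i \<beta> \<nu> \<Longrightarrow> new_cell \<beta> \<nu> = cell d L i (\<nu> i)"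
  by (simp add: new_cell_def skew_adds_in_row)

lemma skew_covered: "\<beta> \<lessdot> \<nu> \<Longrightarrow> skew_diagram d L \<nu> \<beta> = {new_cell \<beta> \<nu>}"
  by (auto simp: adds_cell_def new_cell_in_row skew_adds_in_row)

lemma young_new_cell:
  "\<beta> \<lessdot> \<nu> \<Longrightarrow> young_diagram d L \<beta> = young_diagram d L \<nu> - {new_cell \<beta> \<nu>}"
  using skew_covered[of \<beta> \<nu>] young_diagram_mono[of \<beta> \<nu>] covered_le[of \<beta> \<nu>]
  by (auto simp: skew_diagram_def)

lemma skew_new_cell:
  assumes "\<beta> \<lessdot> \<nu>" "\<And>i. \<mu> i \<le> \<beta> i"
  shows "skew_diagram d L \<nu> \<mu> = insert (new_cell \<beta> \<nu>) (skew_diagram d L \<beta> \<mu>)"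
    and "new_cell \<beta> \<nu> \<notin> skew_diagram d L \<beta> \<mu>"
proof -
  have "young_diagram d L \<mu> \<subseteq> young_diagram d L \<beta>" using assms(2) by (rule young_diagram_mono)
  moreover have "new_cell \<beta> \<nu> \<in> young_diagram d L \<nu>"
    using skew_covered[OF assms(1)] by (auto simp: skew_diagram_def)
  ultimately show "skew_diagram d L \<nu> \<mu> = insert (new_cell \<beta> \<nu>) (skew_diagram d L \<beta> \<mu>)"
    and "new_cell \<beta> \<nu> \<notin> skew_diagram d L \<beta> \<mu>"
    using young_new_cell[OF assms(1)] by (auto simp: skew_diagram_def)
qed

section \<open>Removing the largest entry of a tableau\<close>

definition tableaux ::
    "nat \<Rightarrow> (int \<Rightarrow> int) \<Rightarrow> (int \<Rightarrow> int) \<Rightarrow> ((int \<times> int) set \<Rightarrow> nat) set" where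
  "tableaux n \<nu> \<mu> = {T. is_sct d L \<nu> \<mu> T \<and> card (skew_diagram d L \<nu> \<mu>) = n}"

text \<open>Here the diagram, a set of residue classes of cells, is replaced by inequalities between
  coordinates. The prescribed number of cells moves into the range of the bijection, since
  a bijection onto \<open>{1..n}\<close> already forces the diagram to have \<open>n\<close> cells.\<close>

lemma tableaux_iff:
  "T \<in> tableaux n \<nu> \<mu> \<longleftrightarrow>
     \<nu> \<in> \<Lambda> \<and> \<mu> \<in> \<Lambda> \<and> (\<forall>i. \<mu> i \<le> \<nu> i) \<and>
     T \<in> extensional (skew_diagram d L \<nu> \<mu>) \<and>
     bij_betw T (skew_diagram d L \<nu> \<mu>) {1..n} \<and>
     (\<forall>i j. \<mu> i < j \<and> j + 1 \<le> \<nu> i \<longrightarrow> T (cell d L i j) < T (cell d L i (j + 1))) \<and>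
     (\<forall>i j. \<mu> i < j \<and> j \<le> \<nu> (i + 1) \<longrightarrow> T (cell d L i j) < T (cell d L (i + 1) j))"
  (is "?L \<longleftrightarrow> ?R")
proof -
  have card: "bij_betw T S {1..n} \<longleftrightarrow> bij_betw T S {1..card S} \<and> card S = n" for S
    using bij_betw_same_card[of T S "{1..n}"] by auto
  show ?thesis
  proof (cases "\<nu> \<in> \<Lambda> \<and> \<mu> \<in> \<Lambda>")
    case True
    then have row: "cell d L i j \<in> skew_diagram d L \<nu> \<mu> \<and> cell d L i (j + 1) \<in> skew_diagram d L \<nu> \<mu>
        \<longleftrightarrow> \<mu> i < j \<and> j + 1 \<le> \<nu> i" for i j
      by auto
    have col: "cell d L i j \<in> skew_diagram d L \<nu> \<mu> \<and> cell d L (i + 1) j \<in> skew_diagram d L \<nu> \<mu>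
        \<longleftrightarrow> \<mu> i < j \<and> j \<le> \<nu> (i + 1)" for i j
      using True shape_step[of \<mu> i] shape_step[of \<nu> i] by auto
    show ?thesis
      by (simp only: tableaux_def is_sct_def mem_Collect_eq imp_conjL[symmetric] row col card) blast
  qed (auto simp: tableaux_def is_sct_def)
qed

lemma add_entry:
  assumes "\<beta> \<lessdot> \<nu>" and T: "T \<in> tableaux n \<beta> \<mu>"
  shows "T(new_cell \<beta> \<nu> := Suc n) \<in> tableaux (Suc n) \<nu> \<mu>"
proof -
  obtain i where i: "adds_cell_in_row d L i \<beta> \<nu>" using assms(1) by (auto simp: adds_cell_def)
  define c where "c = new_cell \<beta> \<nu>"
  let ?T = "T(c := Suc n)"
  have sh: "\<beta> \<in> \<Lambda>" "\<nu> \<in> \<Lambda>" "\<mu> \<in> \<Lambda>" and le: "\<And>i. \<mu> i \<le> \<beta> i"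
    and bij: "bij_betw T (skew_diagram d L \<beta> \<mu>) {1..n}"
    and ext: "T \<in> extensional (skew_diagram d L \<beta> \<mu>)"
    using T covered_shapes[OF assms(1)] by (auto simp: tableaux_iff)
  have skew: "skew_diagram d L \<nu> \<mu> = insert c (skew_diagram d L \<beta> \<mu>)"
    and c_new: "c \<notin> skew_diagram d L \<beta> \<mu>"
    using skew_new_cell[OF assms(1) le] by (auto simp: c_def)
  have c_cell: "c = cell d L i (\<nu> i)" using new_cell_in_row[OF i] by (simp add: c_def)
  have old: "T x < Suc n \<and> x \<noteq> c" if "x \<in> skew_diagram d L \<beta> \<mu>" for x
    using bij_betwE[OF bij] that c_new by fastforce
  \<comment> \<open>The new cell is an outer corner, so no cell of the larger diagram lies right of it or below it.\<close>
  have "(\<lambda>r. \<nu> r - row_ind i r) \<in> \<Lambda>" using i by (auto simp: adds_in_row_iff)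
  then have corner: "\<nu> (i + 1) < \<nu> i" using removable_iff[OF sh(2)] by blast
  have right: "cell d L r j \<noteq> c" if "j + 1 \<le> \<nu> r" for r j
  proof
    assume "cell d L r j = c"
    then obtain k :: int where "i = r - k * int d" and j: "\<nu> i = j + k * int L"
      unfolding c_cell cell_eq_iff by blast
    then have "r = i + k * int d" by simp
    then show False using shape_periods[OF sh(2), of i k] j that by simp
  qed
  have below: "cell d L r j \<noteq> c" if "j \<le> \<nu> (r + 1)" for r j
  proof
    assume "cell d L r j = c"
    then obtain k :: int where "i = r - k * int d" and j: "\<nu> i = j + k * int L"
      unfolding c_cell cell_eq_iff by blast
    then have r: "r + 1 = i + 1 + k * int d" by simp
    have "\<nu> (r + 1) = \<nu> (i + 1) - k * int L"
      unfolding r by (rule shape_periods[OF sh(2)])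
    then show False using corner that j by simp
  qed
  have less: "?T x < ?T y" if "x \<noteq> c" "x \<in> skew_diagram d L \<nu> \<mu>" "y \<noteq> c \<Longrightarrow> T x < T y" for x y
    using that old[of x] skew by auto
  have "bij_betw ?T (insert c (skew_diagram d L \<beta> \<mu>)) (insert (Suc n) {1..n})"
  proof -
    have "bij_betw ?T (skew_diagram d L \<beta> \<mu>) {1..n}"
      using bij by (rule bij_betw_cong[THEN iffD1, rotated]) (use old in auto)
    then show ?thesis
      using c_new notIn_Un_bij_betw3[of c "skew_diagram d L \<beta> \<mu>" ?T "{1..n}"] by simp
  qed
  moreover have "insert (Suc n) {1..n} = {1..Suc n}" by auto
  moreover have "?T (cell d L r j) < ?T (cell d L r (j + 1))"
    if "\<mu> r < j" "j + 1 \<le> \<nu> r" for r j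
  proof (rule less)
    assume "cell d L r (j + 1) \<noteq> c"
    moreover have "cell d L r (j + 1) \<in> skew_diagram d L \<nu> \<mu>" using that sh by simp
    ultimately have "j + 1 \<le> \<beta> r" using skew sh by auto
    then show "T (cell d L r j) < T (cell d L r (j + 1))"
      using T that by (auto simp: tableaux_iff)
  qed (use that right sh in auto)
  moreover have "?T (cell d L r j) < ?T (cell d L (r + 1) j)"
    if "\<mu> r < j" "j \<le> \<nu> (r + 1)" for r j
  proof (rule less)
    assume "cell d L (r + 1) j \<noteq> c"
    moreover have "cell d L (r + 1) j \<in> skew_diagram d L \<nu> \<mu>"
      using that sh shape_step[OF sh(3), of r] by simp
    ultimately have "j \<le> \<beta> (r + 1)" using skew sh by auto
    then show "T (cell d L r j) < T (cell d L (r + 1) j)"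
      using T that by (auto simp: tableaux_iff)
  qed (use that below sh shape_step[OF sh(2), of r] in auto)
  moreover have "\<mu> r \<le> \<nu> r" for r using le[of r] covered_le[OF assms(1), of r] by linarith
  moreover have "?T \<in> extensional (insert c (skew_diagram d L \<beta> \<mu>))"
    using ext by (auto simp: extensional_def)
  ultimately show ?thesis
    unfolding c_def[symmetric] tableaux_iff skew using sh by simp
qed

text \<open>The cell holding the largest entry has no cell of the diagram to its right or below it. So it is
  the last cell of a row of \<open>\<nu>\<close> that is longer than the next row, and removing it leaves a shape that
  still contains \<open>\<mu>\<close>.\<close>

lemma remove_entry:
  assumes T: "T \<in> tableaux (Suc n) \<nu> \<mu>"
  obtains \<beta> S where "\<beta> \<lessdot> \<nu>" "S \<in> tableaux n \<beta> \<mu>" "T = S(new_cell \<beta> \<nu> := Suc n)"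
proof -
  have sh: "\<nu> \<in> \<Lambda>" "\<mu> \<in> \<Lambda>" and le: "\<And>i. \<mu> i \<le> \<nu> i"
    and bij: "bij_betw T (skew_diagram d L \<nu> \<mu>) {1..Suc n}"
    and ext: "T \<in> extensional (skew_diagram d L \<nu> \<mu>)"
    and row: "\<And>i j. \<mu> i < j \<Longrightarrow> j + 1 \<le> \<nu> i \<Longrightarrow> T (cell d L i j) < T (cell d L i (j + 1))"
    and col: "\<And>i j. \<mu> i < j \<Longrightarrow> j \<le> \<nu> (i + 1) \<Longrightarrow> T (cell d L i j) < T (cell d L (i + 1) j)"
    using T by (auto simp: tableaux_iff)
  have max: "T x \<le> Suc n" if "x \<in> skew_diagram d L \<nu> \<mu>" for x
    using bij_betwE[OF bij] that by auto
  have "Suc n \<in> T ` skew_diagram d L \<nu> \<mu>" using bij by (auto simp: bij_betw_def)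
  then obtain c where c: "c \<in> skew_diagram d L \<nu> \<mu>" "T c = Suc n" by auto
  obtain i j where c_cell: "c = cell d L i j" using c(1) by (rule skew_cellE)
  have ij: "\<mu> i < j" "j \<le> \<nu> i" using c c_cell sh by auto
  have "\<not> j + 1 \<le> \<nu> i"
    using row[of i j] max[of "cell d L i (j + 1)"] c c_cell ij sh by auto
  then have j: "j = \<nu> i" using ij by simp
  have "\<not> j \<le> \<nu> (i + 1)"
    using col[of i j] max[of "cell d L (i + 1) j"] c c_cell ij sh shape_step[OF sh(2), of i]
    by auto
  then have corner: "\<nu> (i + 1) < \<nu> i" using j by simp
  define \<beta> where "\<beta> = (\<lambda>r. \<nu> r - row_ind i r)"
  have \<beta>: "\<beta> \<in> \<Lambda>" using removable_iff[OF sh(1)] corner by (simp add: \<beta>_def)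
  have add: "adds_cell_in_row d L i \<beta> \<nu>" using \<beta> sh by (auto simp: adds_in_row_iff \<beta>_def)
  then have cov: "\<beta> \<lessdot> \<nu>" by (auto simp: adds_cell_def)
  have c_new: "c = new_cell \<beta> \<nu>" using new_cell_in_row[OF add] c_cell j by simp
  have le_\<beta>: "\<mu> r \<le> \<beta> r" for r
  proof (cases "int d dvd r - i")
    case True
    then obtain k where "r = i + k * int d" using row_class_iff by blast
    then have "\<mu> r < \<nu> r"
      using shape_periods[OF sh(1), of i k] shape_periods[OF sh(2), of i k] ij j by simp
    then show ?thesis using row_ind_le_1[of i r] by (simp add: \<beta>_def)
  next
    case False
    then show ?thesis using le[of r] by (simp add: \<beta>_def row_ind_def)
  qed
  have skew: "skew_diagram d L \<nu> \<mu> = insert c (skew_diagram d L \<beta> \<mu>)"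
    and c_notin: "c \<notin> skew_diagram d L \<beta> \<mu>"
    using skew_new_cell[OF cov le_\<beta>] by (auto simp: c_new)
  define S where "S = restrict T (skew_diagram d L \<beta> \<mu>)"
  have "bij_betw T (skew_diagram d L \<beta> \<mu> \<union> {c}) ({1..n} \<union> {T c})"
    using bij by (simp add: skew c(2) atLeastAtMostSuc_conv)
  then have "bij_betw T (skew_diagram d L \<beta> \<mu>) {1..n}"
    using c_notin c(2) notIn_Un_bij_betw3[of c _ T "{1..n}"] by simp
  then have "bij_betw S (skew_diagram d L \<beta> \<mu>) {1..n}"
    by (simp add: S_def bij_betw_restrict_eq)
  moreover have "S (cell d L r j) < S (cell d L r (j + 1))" if "\<mu> r < j" "j + 1 \<le> \<beta> r" for r j
    using row[of r j] that covered_le[OF cov, of r] \<beta> sh by (simp add: S_def)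
  moreover have "S (cell d L r j) < S (cell d L (r + 1) j)" if "\<mu> r < j" "j \<le> \<beta> (r + 1)" for r j
    using col[of r j] that covered_le[OF cov, of "r + 1"] \<beta> sh shape_step[OF \<beta>, of r]
      shape_step[OF sh(2), of r] by (simp add: S_def)
  ultimately have "S \<in> tableaux n \<beta> \<mu>"
    using \<beta> sh le_\<beta> by (simp add: tableaux_iff S_def)
  moreover have "T = S(new_cell \<beta> \<nu> := Suc n)"
  proof
    fix x
    show "T x = (S(new_cell \<beta> \<nu> := Suc n)) x"
      using c ext skew by (auto simp: c_new[symmetric] S_def extensional_def)
  qed
  ultimately show thesis using that cov by blast
qed

text \<open>Both the removed cell and the smaller tableau can be read off the larger one: the new cell is
  where the largest entry sits, and the shape \<open>\<beta>\<close> is recovered from its Young diagram.\<close>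

lemma add_entry_bij:
  "bij_betw (\<lambda>(\<beta>, T). T(new_cell \<beta> \<nu> := Suc n)) (SIGMA \<beta>:down \<nu>. tableaux n \<beta> \<mu>)
     (tableaux (Suc n) \<nu> \<mu>)"
  (is "bij_betw ?f ?A ?B")
proof (rule bij_betw_imageI)
  show "?f ` ?A = ?B"
  proof
    show "?f ` ?A \<subseteq> ?B" using add_entry by (auto simp: down_def)
    show "?B \<subseteq> ?f ` ?A"
    proof
      fix T assume "T \<in> ?B"
      then obtain \<beta> S where "\<beta> \<lessdot> \<nu>" "S \<in> tableaux n \<beta> \<mu>" "T = S(new_cell \<beta> \<nu> := Suc n)"
        by (rule remove_entry)
      then show "T \<in> ?f ` ?A" by (force simp: down_def)
    qed
  qed
  show "inj_on ?f ?A"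
  proof (rule inj_onI, clarsimp)
    fix \<beta> T \<beta>' T'
    assume cov: "\<beta> \<in> down \<nu>" "\<beta>' \<in> down \<nu>"
      and T: "T \<in> tableaux n \<beta> \<mu>" "T' \<in> tableaux n \<beta>' \<mu>"
      and eq: "T(new_cell \<beta> \<nu> := Suc n) = T'(new_cell \<beta>' \<nu> := Suc n)"
    let ?c = "new_cell \<beta> \<nu>" and ?c' = "new_cell \<beta>' \<nu>"
    have cov': "\<beta> \<lessdot> \<nu>" "\<beta>' \<lessdot> \<nu>" using cov by (auto simp: down_def)
    have le: "\<And>i. \<mu> i \<le> \<beta> i" "\<And>i. \<mu> i \<le> \<beta>' i" using T by (auto simp: tableaux_iff)
    have inj: "inj_on (T(?c := Suc n)) (skew_diagram d L \<nu> \<mu>)"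
      using add_entry[OF cov'(1) T(1)] by (auto simp: tableaux_iff bij_betw_def)
    have c: "?c = ?c'"
    proof (rule inj_onD[OF inj])
      show "(T(?c := Suc n)) ?c = (T(?c := Suc n)) ?c'"
        by (subst (2) eq) simp
    qed (use skew_new_cell(1)[OF cov'(1) le(1)] skew_new_cell(1)[OF cov'(2) le(2)] in auto)
    then have "young_diagram d L \<beta> = young_diagram d L \<beta>'" using young_new_cell cov' by simp
    then have \<beta>: "\<beta> = \<beta>'" using young_diagram_inj cov' covered_shapes by blast
    have "T x = T' x" for x
    proof (cases "x = ?c")
      case True
      have "?c \<notin> skew_diagram d L \<beta> \<mu>" using skew_new_cell(2)[OF cov'(1) le(1)] .
      then show ?thesis using T True by (auto simp: tableaux_iff \<beta> extensional_def)
    next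
      case False
      then show ?thesis using fun_cong[OF eq, of x] c by simp
    qed
    then show "\<beta> = \<beta>' \<and> T = T'" using \<beta> by auto
  qed
qed

section \<open>Counting tableaux\<close>

lemma tableaux_0: "tableaux 0 \<nu> \<mu> = (if \<nu> \<in> \<Lambda> \<and> \<nu> = \<mu> then {\<lambda>_. undefined} else {})"
proof (cases "\<nu> \<in> \<Lambda> \<and> \<nu> = \<mu>")
  case True
  then have "skew_diagram d L \<nu> \<mu> = {}" by (simp add: skew_diagram_def)
  moreover have "\<not> (\<mu> i < j \<and> j \<le> \<nu> (i + 1))" for i j
    using True shape_step[of \<mu> i] by auto
  ultimately show ?thesis using True by (auto simp: tableaux_iff bij_betw_def)
next
  case False
  have eq: "\<nu> = \<mu>" if "T \<in> tableaux 0 \<nu> \<mu>" for T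
  proof
    fix i
    have *: "\<nu> \<in> \<Lambda>" "\<mu> \<in> \<Lambda>" "\<mu> i \<le> \<nu> i" "skew_diagram d L \<nu> \<mu> = {}"
      using that by (auto simp: tableaux_iff bij_betw_def)
    then have "cell d L i (\<nu> i) \<notin> skew_diagram d L \<nu> \<mu>" by simp
    then show "\<nu> i = \<mu> i" using *(1-3) by simp
  qed
  have "T \<notin> tableaux 0 \<nu> \<mu>" for T
    using eq[of T] False unfolding tableaux_iff by blast
  then show ?thesis using False by auto
qed

lemma SCT_outer_eq: "SCT_outer d L n \<alpha> = (SIGMA \<mu>:UNIV. tableaux n \<alpha> \<mu>)"
  by (auto simp: SCT_outer_def tableaux_def)

lemma SCT_inner_eq: "SCT_inner d L n \<alpha> = (SIGMA \<nu>:UNIV. tableaux n \<nu> \<alpha>)"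
  by (auto simp: SCT_inner_def tableaux_def)

lemma bij_betw_Sigma_fibres:
  assumes "\<And>x. bij_betw (g x) (A x) (B x)"
  shows "bij_betw (\<lambda>(x, y). (x, g x y)) (SIGMA x:I. A x) (SIGMA x:I. B x)"
  using assms unfolding bij_betw_def inj_on_def by (auto simp: image_iff) blast+

text \<open>With the outer shape fixed, deleting the largest entry is a first step down from \<open>\<alpha>\<close>, so the
  recursion runs over a varying outer shape.\<close>

lemma card_SCT_outer:
  assumes "\<alpha> \<in> \<Lambda>"
  shows "finite (SCT_outer d L n \<alpha>) \<and> card (SCT_outer d L n \<alpha>) = (D ^^ n) (\<lambda>_. 1) \<alpha>"
  using assms
proof (induction n arbitrary: \<alpha>)
  case 0
  have "SCT_outer d L 0 \<alpha> = {(\<alpha>, \<lambda>_. undefined)}"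
    using 0 by (auto simp: SCT_outer_eq tableaux_0 split: if_splits)
  then show ?case by simp
next
  case (Suc n)
  let ?A = "SIGMA \<mu>:UNIV. SIGMA \<beta>:down \<alpha>. tableaux n \<beta> \<mu>"
  let ?B = "SIGMA \<beta>:down \<alpha>. SCT_outer d L n \<beta>"
  have IH: "finite (SCT_outer d L n \<beta>) \<and> card (SCT_outer d L n \<beta>) = (D ^^ n) (\<lambda>_. 1) \<beta>"
    if "\<beta> \<in> down \<alpha>" for \<beta>
    using Suc.IH that covered_shapes by (auto simp: down_def)
  have "bij_betw (\<lambda>(\<beta>, \<mu>, T). (\<mu>, \<beta>, T)) ?B ?A"
    by (rule bij_betw_byWitness[where f' = "\<lambda>(\<mu>, \<beta>, T). (\<beta>, \<mu>, T)"])
      (auto simp: SCT_outer_eq)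
  moreover have "bij_betw (\<lambda>(\<mu>, \<beta>, T). (\<mu>, T(new_cell \<beta> \<alpha> := Suc n))) ?A (SCT_outer d L (Suc n) \<alpha>)"
    unfolding SCT_outer_eq
    using bij_betw_Sigma_fibres[where I = UNIV, OF add_entry_bij[of \<alpha> n]]
    by (simp add: case_prod_unfold)
  ultimately have bij: "\<exists>f. bij_betw f ?B (SCT_outer d L (Suc n) \<alpha>)"
    using bij_betw_trans by blast
  have "finite ?B" using IH finite_down by (intro finite_SigmaI) auto
  moreover have "card ?B = (D ^^ Suc n) (\<lambda>_. 1) \<alpha>"
    using IH by (simp add: card_SigmaI finite_down D_def)
  ultimately show ?case using bij bij_betw_finite bij_betw_same_card by metis
qed

text \<open>With the inner shape fixed, the largest entry sits at the far end of the chain from \<open>\<alpha>\<close>, where a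
  count alone gives no recursion. Weighting each tableau by a function of its outer shape does: deleting
  the largest entry replaces the weight \<open>f\<close> by \<open>U f\<close>.\<close>

lemma sum_SCT_inner:
  assumes "\<alpha> \<in> \<Lambda>"
  shows "finite (SCT_inner d L n \<alpha>) \<and> (\<Sum>(\<nu>, T)\<in>SCT_inner d L n \<alpha>. f \<nu>) = (U ^^ n) f \<alpha>"
proof (induction n arbitrary: f)
  case 0
  have "SCT_inner d L 0 \<alpha> = {(\<alpha>, \<lambda>_. undefined)}"
    using assms by (auto simp: SCT_inner_eq tableaux_0 split: if_splits)
  then show ?case by simp
next
  case (Suc n)
  let ?A = "SIGMA \<nu>:UNIV. SIGMA \<beta>:down \<nu>. tableaux n \<beta> \<alpha>"
  let ?B = "SIGMA p:SCT_inner d L n \<alpha>. up (fst p)"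
  let ?h = "\<lambda>((\<beta>, T), \<nu>). (\<nu>, \<beta>, T)"
  let ?g = "\<lambda>(\<nu>, \<beta>, T). (\<nu>, T(new_cell \<beta> \<nu> := Suc n))"
  have "bij_betw ?h ?B ?A"
    by (rule bij_betw_byWitness[where f' = "\<lambda>(\<nu>, \<beta>, T). ((\<beta>, T), \<nu>)"])
      (auto simp: SCT_inner_eq up_def down_def)
  moreover have "bij_betw ?g ?A (SCT_inner d L (Suc n) \<alpha>)"
    unfolding SCT_inner_eq
    using bij_betw_Sigma_fibres[where I = UNIV, OF add_entry_bij[of _ n \<alpha>]]
    by (simp add: case_prod_unfold)
  ultimately have bij: "bij_betw (?g \<circ> ?h) ?B (SCT_inner d L (Suc n) \<alpha>)"
    by (rule bij_betw_trans)
  have fin: "finite (SCT_inner d L n \<alpha>)" using Suc.IH by blast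
  then have "finite ?B" by (intro finite_SigmaI) (auto simp: finite_up)
  then have "finite (SCT_inner d L (Suc n) \<alpha>)" using bij_betw_finite[OF bij] by blast
  moreover have "(\<Sum>(\<nu>, T)\<in>SCT_inner d L (Suc n) \<alpha>. f \<nu>) = (\<Sum>(p, \<nu>)\<in>?B. f \<nu>)"
    by (subst sum.reindex_bij_betw[OF bij, symmetric]) (auto intro!: sum.cong)
  moreover have "(\<Sum>(p, \<nu>)\<in>?B. f \<nu>) = (\<Sum>(\<beta>, T)\<in>SCT_inner d L n \<alpha>. U f \<beta>)"
    by (subst sum.Sigma[symmetric]) (auto simp: fin finite_up U_def case_prod_unfold)
  ultimately show ?case using Suc.IH[of "U f"] by (simp add: funpow_swap1)
qed

lemma card_SCT_inner:
  assumes "\<alpha> \<in> \<Lambda>"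
  shows "finite (SCT_inner d L n \<alpha>) \<and> card (SCT_inner d L n \<alpha>) = (U ^^ n) (\<lambda>_. 1) \<alpha>"
  using sum_SCT_inner[OF assms, of n "\<lambda>_. 1"] by (simp add: case_prod_unfold)

lemma foldr_replicate_Plus: "foldr step_op (replicate n Plus) f = (U ^^ n) f"
  by (induction n) simp_all

end

theorem theorem7p3:
  fixes d L n :: nat and \<alpha> :: "int \<Rightarrow> int" and w :: "sign list"
  assumes "d \<ge> 1" and "L \<ge> 1"
    and "\<alpha> \<in> cyl_shapes d L"
    and "length w = n"
  shows "(\<exists>f. bij_betw f (OCT d L w \<alpha>)
            {\<rho> \<in> symmetric_growth_diagrams d L n. \<rho> (0, n) = \<alpha> \<and> \<rho> (n, 0) = \<alpha>})
    \<and> finite (OCT d L w \<alpha>)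
    \<and> (\<forall>w'. length w' = n \<longrightarrow> card (OCT d L w' \<alpha>) = card (OCT d L w \<alpha>))
    \<and> finite (SCT_outer d L n \<alpha>) \<and> card (OCT d L w \<alpha>) = card (SCT_outer d L n \<alpha>)
    \<and> finite (SCT_inner d L n \<alpha>) \<and> card (SCT_outer d L n \<alpha>) = card (SCT_inner d L n \<alpha>)"
proof -
  interpret cylinder d L using assms(1,2) by unfold_locales
  let ?N = "(D ^^ n) (\<lambda>_. 1) \<alpha>"
  let ?G = "{\<rho> \<in> symmetric_growth_diagrams d L n. \<rho> (0, n) = \<alpha> \<and> \<rho> (n, 0) = \<alpha>}"
  have oct: "finite (OCT d L v \<alpha>)" "card (OCT d L v \<alpha>) = ?N" if "length v = n" for v
    using card_OCT[OF assms(3), of v] that by (simp_all add: word_op_eq del: One_nat_def)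
  have "finite ?G" "card ?G = ?N"
    using bij_betw_finite[OF restrict_left_edge_bij[of n \<alpha>]]
      bij_betw_same_card[OF restrict_left_edge_bij[of n \<alpha>]] oct[of "replicate n Minus"] by auto
  then have "\<exists>f. bij_betw f (OCT d L w \<alpha>) ?G"
    using oct assms(4) by (intro finite_same_card_bij) auto
  moreover have "(U ^^ n) (\<lambda>_. 1) \<alpha> = ?N"
    using word_op_eq[of "replicate n Plus"] by (simp add: foldr_replicate_Plus)
  ultimately show ?thesis
    using oct assms(4) card_SCT_outer[OF assms(3), of n] card_SCT_inner[OF assms(3), of n] by auto
qed

end
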